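(* Let $(\Omega,\Sigma,P)$ be a probability space and let $E$ be a vector space over $\mathbb{R}$ with algebraic dual $E^\ast$. Then the map \[ \kappa_0: L^0(\Omega\!:\!E^\ast)\to\mathcal{L}(E\!:\!L^0(\Omega)),\qquad \kappa_0[X](e)=[\omega\mapsto X(\omega)(e)]\quad(e\in E), \] is surjective.
   Context: $L^0(\Omega)$ is the vector space of measurable functions $(\Omega,\Sigma)\to(\mathbb{R},\mathcal{B}(\mathbb{R}))$ modulo $P$-almost sure equality. $\mathcal{L}(E\!:\!L^0(\Omega))$ is the space of all linear maps $E\to L^0(\Omega)$. $\mathbb{R}^E$ carries the Kolmogorov $\sigma$-algebra $\mathcal{B}_K(\mathbb{R}^E)$ generated by the sets $\{f\in\mathbb{R}^E: f(e)\in B\}$, $e\in E$, $B\in\mathcal{B}(\mathbb{R})$. The algebraic dual $E^\ast\subset\mathbb{R}^E$ (all linear maps $E\to\mathbb{R}$) carries the restriction $E^\ast\cap\mathcal{B}_K(\mathbb{R}^E)$; thus $X:\Omega\to E^\ast$ is measurable iff $\omega\mapsto X(\omega)(e)$ is measurable for every $e\in E$. $L^0(\Omega\!:\!E^\ast)$ is the set of measurable maps $\Omega\to E^\ast$ modulo strict equivalence: $X_1,X_2$ are identified iff there is a set $\Omega_1\subset\Omega$ with $P(\Omega_1)=1$ and $X_1(\omega)=X_2(\omega)$ in $E^\ast$ for all $\omega\in\Omega_1$. The map $\kappa_0$ is well defined on equivalence classes. *)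

theory Defs
  imports "HOL-Probability.Probability"
begin

definition ae_rel :: "'a measure \<Rightarrow> (('a \<Rightarrow> real) \<times> ('a \<Rightarrow> real)) set" where
  "ae_rel M = {(f, g). f \<in> borel_measurable M \<and> g \<in> borel_measurable M \<and> (AE \<omega> in M. f \<omega> = g \<omega>)}"

definition L0 :: "'a measure \<Rightarrow> ('a \<Rightarrow> real) set set" where
  "L0 M = borel_measurable M // ae_rel M"

(* The operations on L0 M are computed on representatives; the unions below are over
   equal sets, see L0_add_class and L0_scale_class. *)

definition L0_add :: "'a measure \<Rightarrow> ('a \<Rightarrow> real) set \<Rightarrow> ('a \<Rightarrow> real) set \<Rightarrow> ('a \<Rightarrow> real) set" where
  "L0_add M A B = (\<Union>f\<in>A. \<Union>g\<in>B. ae_rel M `` {\<lambda>\<omega>. f \<omega> + g \<omega>})"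

definition L0_scale :: "'a measure \<Rightarrow> real \<Rightarrow> ('a \<Rightarrow> real) set \<Rightarrow> ('a \<Rightarrow> real) set" where
  "L0_scale M c A = (\<Union>f\<in>A. ae_rel M `` {\<lambda>\<omega>. c * f \<omega>})"

definition linear_maps_L0 :: "'a measure \<Rightarrow> ('e::real_vector \<Rightarrow> ('a \<Rightarrow> real) set) set" where
  "linear_maps_L0 M = {T. (\<forall>e. T e \<in> L0 M) \<and>
     (\<forall>d e. T (d + e) = L0_add M (T d) (T e)) \<and>
     (\<forall>c e. T (c *\<^sub>R e) = L0_scale M c (T e))}"

definition algebraic_dual :: "('e::real_vector \<Rightarrow> real) set" where
  "algebraic_dual = {f. linear f}"

definition kolmogorov :: "('e \<Rightarrow> real) measure" where
  "kolmogorov = sigma UNIV {{f. f e \<in> B} | e B. B \<in> sets (borel :: real measure)}"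

definition dual_space :: "('e::real_vector \<Rightarrow> real) measure" where
  "dual_space = restrict_space kolmogorov algebraic_dual"

(* The event {X = Y} need not be measurable, hence the explicit set W of full measure. *)
definition strict_rel ::
    "'a measure \<Rightarrow> (('a \<Rightarrow> 'e::real_vector \<Rightarrow> real) \<times> ('a \<Rightarrow> 'e \<Rightarrow> real)) set" where
  "strict_rel M = {(X, Y). X \<in> M \<rightarrow>\<^sub>M dual_space \<and> Y \<in> M \<rightarrow>\<^sub>M dual_space \<and>
     (\<exists>W\<in>sets M. measure M W = 1 \<and> (\<forall>\<omega>\<in>W. X \<omega> = Y \<omega>))}"

definition L0_dual :: "'a measure \<Rightarrow> ('a \<Rightarrow> 'e::real_vector \<Rightarrow> real) set set" where
  "L0_dual M = (M \<rightarrow>\<^sub>M dual_space) // strict_rel M"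

(* Computed on representatives; see kappa0_class. *)
definition kappa0 ::
    "'a measure \<Rightarrow> ('a \<Rightarrow> 'e::real_vector \<Rightarrow> real) set \<Rightarrow> 'e \<Rightarrow> ('a \<Rightarrow> real) set" where
  "kappa0 M A = (\<lambda>e. \<Union>X\<in>A. ae_rel M `` {\<lambda>\<omega>. X \<omega> e})"

lemma equiv_ae_rel: "equiv (borel_measurable M) (ae_rel M)"
proof (rule equivI)
  show "ae_rel M \<subseteq> borel_measurable M \<times> borel_measurable M"
    by (auto simp: ae_rel_def)
  show "refl_on (borel_measurable M) (ae_rel M)"
    by (auto simp: refl_on_def ae_rel_def)
  show "sym (ae_rel M)"
    by (auto simp: sym_def ae_rel_def elim: eventually_mono)
  show "trans (ae_rel M)"
  proof (rule transI)
    fix f g h assume "(f, g) \<in> ae_rel M" "(g, h) \<in> ae_rel M"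
    then show "(f, h) \<in> ae_rel M"
      unfolding ae_rel_def by (auto elim: eventually_elim2)
  qed
qed

lemma L0_add_class:
  assumes "f \<in> borel_measurable M" "g \<in> borel_measurable M"
  shows "L0_add M (ae_rel M `` {f}) (ae_rel M `` {g}) = ae_rel M `` {\<lambda>\<omega>. f \<omega> + g \<omega>}"
  unfolding L0_add_def
proof (rule UN_equiv_class2[OF equiv_ae_rel equiv_ae_rel _ assms])
  show "congruent2 (ae_rel M) (ae_rel M) (\<lambda>f g. ae_rel M `` {\<lambda>\<omega>. f \<omega> + g \<omega>})"
    by (rule congruent2I', rule equiv_class_eq[OF equiv_ae_rel])
       (auto simp: ae_rel_def elim: eventually_elim2)
qed

lemma L0_scale_class:
  assumes "f \<in> borel_measurable M"
  shows "L0_scale M c (ae_rel M `` {f}) = ae_rel M `` {\<lambda>\<omega>. c * f \<omega>}"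
  unfolding L0_scale_def
proof (rule UN_equiv_class[OF equiv_ae_rel _ assms])
  show "congruent (ae_rel M) (\<lambda>f. ae_rel M `` {\<lambda>\<omega>. c * f \<omega>})"
    by (rule congruentI, rule equiv_class_eq[OF equiv_ae_rel])
       (auto simp: ae_rel_def elim: eventually_mono)
qed

lemma space_dual_space: "space dual_space = algebraic_dual"
  by (simp add: dual_space_def kolmogorov_def space_restrict_space)

lemma measurable_dual_space_iff:
  fixes X :: "'a \<Rightarrow> 'e::real_vector \<Rightarrow> real"
  shows "X \<in> M \<rightarrow>\<^sub>M dual_space \<longleftrightarrow>
     (\<forall>\<omega>\<in>space M. linear (X \<omega>)) \<and> (\<forall>e. (\<lambda>\<omega>. X \<omega> e) \<in> borel_measurable M)"
proof -
  have "X \<in> M \<rightarrow>\<^sub>M (kolmogorov :: ('e \<Rightarrow> real) measure) \<longleftrightarrow> (\<forall>e. (\<lambda>\<omega>. X \<omega> e) \<in> borel_measurable M)"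
  proof safe
    fix e assume X: "X \<in> M \<rightarrow>\<^sub>M kolmogorov"
    have "X -` {f. f e \<in> B} \<inter> space M \<in> sets M" if "B \<in> sets borel" for B
      by (rule measurable_sets[OF X]) (use that in \<open>auto simp: kolmogorov_def\<close>)
    then show "(\<lambda>\<omega>. X \<omega> e) \<in> borel_measurable M"
      by (intro measurableI) (auto simp: vimage_def)
  next
    assume X: "\<forall>e. (\<lambda>\<omega>. X \<omega> e) \<in> borel_measurable M"
    show "X \<in> M \<rightarrow>\<^sub>M kolmogorov"
      unfolding kolmogorov_def
    proof (rule measurable_measure_of)
      fix C :: "('e \<Rightarrow> real) set" assume "C \<in> {{f. f e \<in> B} | e B. B \<in> sets (borel :: real measure)}"
      then obtain e :: 'e and B where C: "C = {f. f e \<in> B}" and B: "B \<in> sets (borel :: real measure)"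
        by blast
      have "X -` C \<inter> space M = (\<lambda>\<omega>. X \<omega> e) -` B \<inter> space M"
        by (auto simp: C)
      then show "X -` C \<inter> space M \<in> sets M"
        using X B by (auto intro: measurable_sets)
    qed auto
  qed
  then show ?thesis
    by (auto simp: dual_space_def measurable_restrict_space2_iff algebraic_dual_def)
qed

lemma equiv_strict_rel:
  assumes "prob_space M"
  shows "equiv (M \<rightarrow>\<^sub>M dual_space) (strict_rel M)"
proof -
  interpret prob_space M by fact
  show ?thesis
  proof (rule equivI)
    show "strict_rel M \<subseteq> (M \<rightarrow>\<^sub>M dual_space) \<times> (M \<rightarrow>\<^sub>M dual_space)"
      by (auto simp: strict_rel_def)
    show "refl_on (M \<rightarrow>\<^sub>M dual_space) (strict_rel M)"
      using prob_space by (auto simp: refl_on_def strict_rel_def)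
    show "sym (strict_rel M)"
      by (fastforce simp: sym_def strict_rel_def)
    show "trans (strict_rel M)"
    proof (rule transI)
      fix X Y Z assume XY: "(X, Y) \<in> strict_rel M" and YZ: "(Y, Z) \<in> strict_rel M"
      from XY obtain U where U: "U \<in> sets M" "prob U = 1" "\<forall>\<omega>\<in>U. X \<omega> = Y \<omega>"
        by (auto simp: strict_rel_def)
      from YZ obtain V where V: "V \<in> sets M" "prob V = 1" "\<forall>\<omega>\<in>V. Y \<omega> = Z \<omega>"
        by (auto simp: strict_rel_def)
      have "AE \<omega> in M. \<omega> \<in> U \<inter> V"
        using AE_prob_1[OF U(2)] AE_prob_1[OF V(2)] by eventually_elim simp
      then have "prob (U \<inter> V) = 1"
        using U V by (simp add: prob_eq_1)
      then have "\<exists>W\<in>sets M. prob W = 1 \<and> (\<forall>\<omega>\<in>W. X \<omega> = Z \<omega>)"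
        using U V by (intro bexI[of _ "U \<inter> V"]) auto
      then show "(X, Z) \<in> strict_rel M"
        using XY YZ by (auto simp: strict_rel_def)
    qed
  qed
qed

lemma kappa0_class:
  fixes X :: "'a \<Rightarrow> 'e::real_vector \<Rightarrow> real"
  assumes "prob_space M" "X \<in> M \<rightarrow>\<^sub>M dual_space"
  shows "kappa0 M (strict_rel M `` {X}) e = ae_rel M `` {\<lambda>\<omega>. X \<omega> e}"
  unfolding kappa0_def
proof (rule UN_equiv_class[OF equiv_strict_rel _ assms(2)])
  interpret prob_space M by fact
  show "congruent (strict_rel M) (\<lambda>X :: 'a \<Rightarrow> 'e \<Rightarrow> real. ae_rel M `` {\<lambda>\<omega>. X \<omega> e})"
  proof (rule congruentI, rule equiv_class_eq[OF equiv_ae_rel])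
    fix X Y :: "'a \<Rightarrow> 'e \<Rightarrow> real"
    assume XY: "(X, Y) \<in> strict_rel M"
    then obtain W where W: "W \<in> sets M" "prob W = 1" "\<forall>\<omega>\<in>W. X \<omega> = Y \<omega>"
      by (auto simp: strict_rel_def)
    then have "AE \<omega> in M. \<omega> \<in> W"
      using prob_eq_1 by simp
    then have "AE \<omega> in M. X \<omega> e = Y \<omega> e"
      by (rule eventually_mono) (use W in auto)
    then show "(\<lambda>\<omega>. X \<omega> e, \<lambda>\<omega>. Y \<omega> e) \<in> ae_rel M"
      using XY by (auto simp: ae_rel_def strict_rel_def measurable_dual_space_iff)
  qed
qed (fact assms(1))

end

theory Submission
  imports Defs
begin

text \<open>
  The idea is to lift on a Hamel basis. Given a linear \<open>T\<close> from \<open>E\<close> to \<open>L\<^sup>0\<close>, choose a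
  representative \<open>t b\<close> of \<open>T b\<close> for every vector \<open>b\<close> of a basis \<open>B\<close> of \<open>E\<close>, and for each \<open>\<omega>\<close>
  let \<open>X \<omega>\<close> be the linear functional with \<open>X \<omega> b = t b \<omega>\<close> on \<open>B\<close>. Linearity of \<open>X \<omega>\<close> then holds at
  every \<open>\<omega>\<close>, even though \<open>T\<close> is linear only up to null sets that depend on the vectors involved
  and that may be uncountably many: the basis vectors satisfy no linear relation, so no
  relation is demanded of the functions \<open>t b\<close>.
  Every vector is a finite combination of basis vectors, so only finitely many null sets
  matter for it; hence \<open>\<omega> \<mapsto> X \<omega> e\<close> is measurable and represents \<open>T e\<close>. The last step
  is the lemma \<open>subspace_represented\<close>: the vectors \<open>e\<close> for which this is so form a subspace.
  That \<open>\<kappa>\<^sub>0\<close> takes its values in the linear maps is the easy half, \<open>kappa0_class_linear\<close>.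
\<close>

lemma ae_class_in_L0: "f \<in> borel_measurable M \<Longrightarrow> ae_rel M `` {f} \<in> L0 M"
  unfolding L0_def by (rule quotientI)

lemma L0_E:
  assumes "A \<in> L0 M"
  obtains f where "f \<in> borel_measurable M" "A = ae_rel M `` {f}"
  using assms unfolding L0_def by (rule quotientE)

text \<open>
  It is this closure property that replaces a calculation with finite linear combinations: it
  passes from a basis to its whole span.
\<close>

lemma subspace_represented:
  fixes X :: "'a \<Rightarrow> 'e::real_vector \<Rightarrow> real"
  assumes lin: "\<And>\<omega>. linear (X \<omega>)" and T: "T \<in> linear_maps_L0 M"
  shows "subspace {e. (\<lambda>\<omega>. X \<omega> e) \<in> borel_measurable M \<and> T e = ae_rel M `` {\<lambda>\<omega>. X \<omega> e}}"
    (is "subspace ?S")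
proof (rule subspaceI)
  have add: "T (d + e) = L0_add M (T d) (T e)" for d e
    using T by (simp add: linear_maps_L0_def)
  have scale: "T (c *\<^sub>R e) = L0_scale M c (T e)" for c e
    using T by (simp add: linear_maps_L0_def)
  have "T 0 \<in> L0 M"
    using T by (simp add: linear_maps_L0_def)
  then obtain f where f: "f \<in> borel_measurable M" "T 0 = ae_rel M `` {f}"
    by (rule L0_E)
  \<comment> \<open>Homogeneity with the scalar \<open>0\<close> gives \<open>T 0 = [0]\<close>, whatever the representative of \<open>T 0\<close>.\<close>
  have "T 0 = ae_rel M `` {\<lambda>\<omega>. 0}"
    using scale[of 0 0] L0_scale_class[OF f(1), of 0] f(2) by simp
  then show "0 \<in> ?S"
    by (simp add: linear_0[OF lin])
  show "d + e \<in> ?S" if "d \<in> ?S" "e \<in> ?S" for d e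
    using that by (simp add: add linear_add[OF lin] L0_add_class borel_measurable_add)
  show "c *\<^sub>R e \<in> ?S" if "e \<in> ?S" for c e
    using that by (simp add: scale linear_scale[OF lin] L0_scale_class borel_measurable_times)
qed

lemma exists_dual_valued_lift:
  fixes T :: "'e::real_vector \<Rightarrow> ('a \<Rightarrow> real) set"
  assumes T: "T \<in> linear_maps_L0 M"
  obtains X where "X \<in> M \<rightarrow>\<^sub>M dual_space" "\<And>e. T e = ae_rel M `` {\<lambda>\<omega>. X \<omega> e}"
proof -
  obtain B :: "'e set" where B: "independent B" "span B = UNIV"
    using independent_extend_basis[OF independent_empty] span_extend_basis[OF independent_empty]
    by blast
  have "\<exists>f. f \<in> borel_measurable M \<and> T e = ae_rel M `` {f}" for e
  proof -
    have "T e \<in> L0 M"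
      using T by (simp add: linear_maps_L0_def)
    then show ?thesis
      by (rule L0_E) blast
  qed
  then obtain t where t: "\<And>e. t e \<in> borel_measurable M" "\<And>e. T e = ae_rel M `` {t e}"
    by metis
  have "\<exists>g. linear g \<and> (\<forall>b\<in>B. g b = t b \<omega>)" for \<omega>
    by (rule linear_independent_extend[OF B(1)])
  then obtain X where lin: "\<And>\<omega>. linear (X \<omega>)" and X: "\<And>\<omega> b. b \<in> B \<Longrightarrow> X \<omega> b = t b \<omega>"
    by metis
  let ?S = "{e. (\<lambda>\<omega>. X \<omega> e) \<in> borel_measurable M \<and> T e = ae_rel M `` {\<lambda>\<omega>. X \<omega> e}}"
  have "B \<subseteq> ?S"
    using t X by auto
  then have "span B \<subseteq> ?S"
    by (rule span_minimal[OF _ subspace_represented[OF lin T]])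
  then have "e \<in> ?S" for e
    using B(2) by auto
  then show thesis
    using lin by (intro that[of X]) (auto simp: measurable_dual_space_iff)
qed

lemma kappa0_class_linear:
  fixes X :: "'a \<Rightarrow> 'e::real_vector \<Rightarrow> real"
  assumes M: "prob_space M" and X: "X \<in> M \<rightarrow>\<^sub>M dual_space"
  shows "kappa0 M (strict_rel M `` {X}) \<in> linear_maps_L0 M"
proof -
  have meas: "(\<lambda>\<omega>. X \<omega> e) \<in> borel_measurable M" for e
    using X by (simp add: measurable_dual_space_iff)
  have lin: "linear (X \<omega>)" if "\<omega> \<in> space M" for \<omega>
    using X that by (simp add: measurable_dual_space_iff)
  \<comment> \<open>Outside \<open>space M\<close> the function \<open>X \<omega>\<close> is arbitrary, so linearity passes to the classes
    through almost sure equality and not through equality of functions.\<close>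
  have "ae_rel M `` {\<lambda>\<omega>. X \<omega> (d + e)} = ae_rel M `` {\<lambda>\<omega>. X \<omega> d + X \<omega> e}" for d e
    by (rule equiv_class_eq[OF equiv_ae_rel])
       (auto simp: ae_rel_def meas borel_measurable_add linear_add[OF lin] intro!: AE_I2)
  moreover have "ae_rel M `` {\<lambda>\<omega>. X \<omega> (c *\<^sub>R e)} = ae_rel M `` {\<lambda>\<omega>. c * X \<omega> e}" for c e
    by (rule equiv_class_eq[OF equiv_ae_rel])
       (auto simp: ae_rel_def meas borel_measurable_times linear_scale[OF lin] intro!: AE_I2)
  ultimately show ?thesis
    by (simp add: linear_maps_L0_def kappa0_class[OF M X] L0_add_class L0_scale_class meas
        ae_class_in_L0)
qed

theorem proposition4p1:
  fixes M :: "'a measure"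
  assumes "prob_space M"
  shows "kappa0 M ` (L0_dual M :: ('a \<Rightarrow> 'e::real_vector \<Rightarrow> real) set set) = linear_maps_L0 M"
proof (intro equalityI subsetI)
  fix T :: "'e \<Rightarrow> ('a \<Rightarrow> real) set"
  assume "T \<in> kappa0 M ` L0_dual M"
  then show "T \<in> linear_maps_L0 M"
    by (auto simp: L0_dual_def elim!: quotientE intro: kappa0_class_linear[OF assms])
next
  fix T :: "'e \<Rightarrow> ('a \<Rightarrow> real) set"
  assume "T \<in> linear_maps_L0 M"
  then obtain X where X: "X \<in> M \<rightarrow>\<^sub>M dual_space" "\<And>e. T e = ae_rel M `` {\<lambda>\<omega>. X \<omega> e}"
    by (rule exists_dual_valued_lift) blast
  then have "T = kappa0 M (strict_rel M `` {X})"
    by (simp add: fun_eq_iff kappa0_class[OF assms])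
  moreover have "strict_rel M `` {X} \<in> L0_dual M"
    unfolding L0_dual_def using X(1) by (rule quotientI)
  ultimately show "T \<in> kappa0 M ` L0_dual M"
    by blast
qed

end
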